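(* Suppose that $\mathbf{W}_1,\dots,\mathbf{W}_T$ are independent, that $\mathbf{W}=(\mathbf{W}_1,\dots,\mathbf{W}_T)$ takes a finite number of values, and that all functions $\mathcal{V}_t$ defined by the Bellman equation $$\mathcal{V}_T(x,z)=K(x)+\chi_{\{g(x)-z\le 0\}}(x,z),$$ $$\mathcal{V}_t(x,z)=\min_{u\in\mathbb{U}_t}\ \min_{\substack{\sigma(\mathbf{V})\subset\sigma(\mathbf{W}_{t+1})\\ \mathbb{E}[\mathbf{V}]=0}}\ \mathbb{E}\Big[L_t(x,u,\mathbf{W}_{t+1})+\mathcal{V}_{t+1}\big(f_t(x,u,\mathbf{W}_{t+1}),z+\mathbf{V}\big)\Big],\quad t=T-1,\dots,0,$$ are measurable. Let $(\phi_0^\sharp,\dots,\phi_{T-1}^\sharp)$ and $(\varphi_0^\sharp,\dots,\varphi_{T-1}^\sharp)$ be optimal strategies obtained by solving this Bellman equation, that is, $\phi_t^\sharp\in\mathcal{U}_t$ and $\varphi_t^\sharp\in\mathcal{Y}_t$ are such that for every $t\in\{0,\dots,T-1\}$ and every $(x,z)\in\mathbb{X}_t\times\mathbb{R}^m$ the pair $\big(u,\mathbf{V}\big)=\big(\phi_t^\sharp(x,z),\varphi_t^\sharp(x,z,\mathbf{W}_{t+1})\big)$ attains the minimum defining $\mathcal{V}_t(x,z)$. Then the sequence $\big((\phi_0^\sharp,\varphi_0^\sharp),\dots,(\phi_{T-1}^\sharp,\varphi_{T-1}^\sharp)\big)$ is time consistent for the optimization data set $$\mathcal{E}=\big(\{0,\dots,T-1\},\{\mathbb{X}_t\times\mathbb{R}^m\}_t,\{\mathcal{U}_t\times\mathcal{Y}_t\}_t,\{J_t\}_t\big);$$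 that is, for every $t\in\{0,\dots,T-1\}$ and every $(x_t,z_t)\in\mathbb{X}_t\times\mathbb{R}^m$, the truncated sequence $(\phi_t^\sharp,\varphi_t^\sharp,\dots,\phi_{T-1}^\sharp,\varphi_{T-1}^\sharp)$ minimizes $J_t(x_t,z_t,\cdot)$ over $\mathcal{U}_t\times\mathcal{Y}_t\times\dots\times\mathcal{U}_{T-1}\times\mathcal{Y}_{T-1}$.
   Context: Setting. $(\Omega,\mathcal{A},\mathbb{P})$ is a probability space, and $T>0$ and $m\ge 1$ are integers. $\mathbb{X}_0,\dots,\mathbb{X}_T$, $\mathbb{U}_0,\dots,\mathbb{U}_{T-1}$, $\mathbb{W}_1,\dots,\mathbb{W}_T$ are measurable spaces; $\mathbf{W}_t$ is a random variable with values in $\mathbb{W}_t$. The following maps are measurable: $f_t:\mathbb{X}_t\times\mathbb{U}_t\times\mathbb{W}_{t+1}\to\mathbb{X}_{t+1}$ and $L_t:\mathbb{X}_t\times\mathbb{U}_t\times\mathbb{W}_{t+1}\to\mathbb{R}_+\cup\{+\infty\}$ for $t=0,\dots,T-1$, $K:\mathbb{X}_T\to\mathbb{R}_+\cup\{+\infty\}$, and $g:\mathbb{X}_T\to\mathbb{R}_+^m$. Inequalities in $\mathbb{R}^m$ are componentwise. $\sigma(\cdot)$ denotes the generated $\sigma$-field. $\chi_{\{g(x)-z\le 0\}}(x,z)$ equals $0$ if $g(x)-z\le 0$ and $+\infty$ otherwise. In the Bellman equation $\mathbf{V}$ ranges over $\mathbb{R}^m$-valued random variables. Strategies. $\mathcal{U}_t$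 is the space of measurable mappings $\phi_t:\mathbb{X}_t\times\mathbb{R}^m\to\mathbb{U}_t$, and $\mathcal{Y}_t$ is the space of measurable mappings $\varphi_t:\mathbb{X}_t\times\mathbb{R}^m\times\mathbb{W}_{t+1}\to\mathbb{R}^m$. Cost functions. For $t\in\{0,\dots,T-1\}$, given $(x_t,z_t)$ and $(\phi_\tau,\varphi_\tau)_{\tau=t,\dots,T-1}$, let $\mathbf{X}_t=x_t$, $\mathbf{Z}_t=z_t$ and, for $\tau=t,\dots,T-1$, $\mathbf{X}_{\tau+1}=f_\tau(\mathbf{X}_\tau,\phi_\tau(\mathbf{X}_\tau,\mathbf{Z}_\tau),\mathbf{W}_{\tau+1})$ and $\mathbf{Z}_{\tau+1}=\mathbf{Z}_\tau+\varphi_\tau(\mathbf{X}_\tau,\mathbf{Z}_\tau,\mathbf{W}_{\tau+1})$. Then $$J_t(x_t,z_t,\phi_t,\varphi_t,\dots,\phi_{T-1},\varphi_{T-1})=\mathbb{E}\Big[\sum_{\tau=t}^{T-1}L_\tau(\mathbf{X}_\tau,\phi_\tau(\mathbf{X}_\tau,\mathbf{Z}_\tau),\mathbf{W}_{\tau+1})+K(\mathbf{X}_T)+\chi_{\{g(x)-z\le 0\}}(\mathbf{X}_T,\mathbf{Z}_T)\Big]$$ if $\mathbb{E}[\varphi_\tau(\mathbf{X}_\tau,\mathbf{Z}_\tau,\mathbf{W}_{\tau+1})\mid\mathbf{X}_\tau,\mathbf{Z}_\tau]=0$ for all $\tau=t,\dots,T-1$, and $J_t=+\infty$ otherwise. Time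 consistency. An optimization data set is $\mathcal{D}=(\mathcal{T},\{A_t\},\{U_t\},\{J_t\})$ with $\mathcal{T}=\{t_i,\dots,t_f\}$ a finite integer interval, parameter sets $A_t$, control sets $U_t$ and cost functions $J_t:A_t\times U_t\times\dots\times U_{t_f}\to\mathbb{R}\cup\{+\infty\}$. A sequence $(u_t^\sharp,\dots,u_{t_f}^\sharp)$ is a universal solution for $\mathcal{D}$ at time $t$ if it minimizes $J_t(a_t,\cdot)$ over $U_t\times\dots\times U_{t_f}$ for every $a_t\in A_t$. A sequence $(u_{t_i}^\sharp,\dots,u_{t_f}^\sharp)$ is time consistent for $\mathcal{D}$ if for every $t\in\mathcal{T}$ the truncated sequence $(u_t^\sharp,\dots,u_{t_f}^\sharp)$ is a universal solution for $\mathcal{D}$ at time $t$. *)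

theory Defs
  imports "HOL-Probability.Probability"
begin

text \<open>
  The spaces of a family such as \<open>state_space P 0, \<dots>, state_space P T\<close> are arbitrary and may
  differ from one another; they are measurable spaces over a common type, and points of a space
  are the elements of its carrier. Only the \<open>\<sigma>\<close>-algebras of these measures are used.
  The dimension \<open>m \<ge> 1\<close> is \<open>CARD('m)\<close>, and the order on \<^typ>\<open>real ^ 'm\<close> is componentwise.
\<close>

record ('o, 'x, 'u, 'w, 'm::finite) control_problem =
  base :: "'o measure"
  horizon :: nat
  state_space :: "nat \<Rightarrow> 'x measure"
  control_space :: "nat \<Rightarrow> 'u measure"
  noise_space :: "nat \<Rightarrow> 'w measure"
  noise :: "nat \<Rightarrow> 'o \<Rightarrow> 'w"
  dynamics :: "nat \<Rightarrow> 'x \<times> 'u \<times> 'w \<Rightarrow> 'x"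
  stage_cost :: "nat \<Rightarrow> 'x \<times> 'u \<times> 'w \<Rightarrow> ennreal"
  final_cost :: "'x \<Rightarrow> ennreal"
  target :: "'x \<Rightarrow> (real ^ 'm)"

locale stochastic_control_problem = prob_space "base P"
  for P :: "('o, 'x, 'u, 'w, 'm::finite) control_problem" +
  assumes horizon_pos: "horizon P > 0"
    and noise_measurable:
      "\<And>t. t \<in> {1..horizon P} \<Longrightarrow> noise P t \<in> base P \<rightarrow>\<^sub>M noise_space P t"
    and dynamics_measurable:
      "\<And>t. t < horizon P \<Longrightarrow>
        dynamics P t \<in> state_space P t \<Otimes>\<^sub>M control_space P t \<Otimes>\<^sub>M noise_space P (Suc t)
                        \<rightarrow>\<^sub>M state_space P (Suc t)"
    and stage_cost_measurable:
      "\<And>t. t < horizon P \<Longrightarrow>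
        stage_cost P t \<in> state_space P t \<Otimes>\<^sub>M control_space P t \<Otimes>\<^sub>M noise_space P (Suc t)
                          \<rightarrow>\<^sub>M borel"
    and final_cost_measurable: "final_cost P \<in> state_space P (horizon P) \<rightarrow>\<^sub>M borel"
    and target_measurable: "target P \<in> state_space P (horizon P) \<rightarrow>\<^sub>M borel"
    and target_nonneg: "\<And>x. x \<in> space (state_space P (horizon P)) \<Longrightarrow> 0 \<le> target P x"

definition target_indicator ::
  "('o, 'x, 'u, 'w, 'm::finite) control_problem \<Rightarrow> 'x \<times> (real ^ 'm) \<Rightarrow> ennreal" where
  "target_indicator P = (\<lambda>(x, z). if target P x - z \<le> 0 then 0 else \<infinity>)"


subsection \<open>Bellman equation\<close>

definition increments ::
  "('o, 'x, 'u, 'w, 'm::finite) control_problem \<Rightarrow> nat \<Rightarrow> ('o \<Rightarrow> (real ^ 'm)) set" where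
  "increments P t =
    {V \<in> borel_measurable (base P).
       sets (vimage_algebra (space (base P)) V borel)
         \<subseteq> sets (vimage_algebra (space (base P)) (noise P (Suc t)) (noise_space P (Suc t))) \<and>
       has_bochner_integral (base P) V 0}"

definition bellman_objective ::
  "('o, 'x, 'u, 'w, 'm::finite) control_problem \<Rightarrow> nat \<Rightarrow> ('x \<times> (real ^ 'm) \<Rightarrow> ennreal) \<Rightarrow>
    'x \<times> (real ^ 'm) \<Rightarrow> 'u \<Rightarrow> ('o \<Rightarrow> (real ^ 'm)) \<Rightarrow> ennreal" where
  "bellman_objective P t v = (\<lambda>(x, z) u V.
    \<integral>\<^sup>+ \<omega>. stage_cost P t (x, u, noise P (Suc t) \<omega>)
         + v (dynamics P t (x, u, noise P (Suc t) \<omega>), z + V \<omega>) \<partial>base P)"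

text \<open>
  The minima of the Bellman equation are written as infima; that they are attained is part of
  \<open>bellman_optimal\<close> below.
\<close>

function bellman_value ::
  "('o, 'x, 'u, 'w, 'm::finite) control_problem \<Rightarrow> nat \<Rightarrow> 'x \<times> (real ^ 'm) \<Rightarrow> ennreal" where
  "bellman_value P t =
    (if t \<ge> horizon P then (\<lambda>(x, z). final_cost P x + target_indicator P (x, z))
     else (\<lambda>(x, z). INF u \<in> space (control_space P t). INF V \<in> increments P t.
            bellman_objective P t (bellman_value P (Suc t)) (x, z) u V))"
  by auto
termination
  by (relation "Wellfounded.measure (\<lambda>(P, t). horizon P - t)") auto

declare bellman_value.simps [simp del]

definition bellman_optimal ::
  "('o, 'x, 'u, 'w, 'm::finite) control_problem \<Rightarrow> nat \<Rightarrow>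
    ('x \<times> (real ^ 'm) \<Rightarrow> 'u) \<Rightarrow> ('x \<times> (real ^ 'm) \<times> 'w \<Rightarrow> (real ^ 'm)) \<Rightarrow> bool" where
  "bellman_optimal P t \<phi> \<psi> \<longleftrightarrow>
    (\<forall>x \<in> space (state_space P t). \<forall>z.
      let u = \<phi> (x, z); V = (\<lambda>\<omega>. \<psi> (x, z, noise P (Suc t) \<omega>)) in
        u \<in> space (control_space P t) \<and> V \<in> increments P t \<and>
        bellman_objective P t (bellman_value P (Suc t)) (x, z) u V = bellman_value P t (x, z))"


subsection \<open>Strategies and their cost\<close>

definition state_strategies ::
  "('o, 'x, 'u, 'w, 'm::finite) control_problem \<Rightarrow> nat \<Rightarrow> ('x \<times> (real ^ 'm) \<Rightarrow> 'u) set" where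
  "state_strategies P t = state_space P t \<Otimes>\<^sub>M borel \<rightarrow>\<^sub>M control_space P t"

definition increment_strategies ::
  "('o, 'x, 'u, 'w, 'm::finite) control_problem \<Rightarrow> nat \<Rightarrow>
    ('x \<times> (real ^ 'm) \<times> 'w \<Rightarrow> (real ^ 'm)) set" where
  "increment_strategies P t =
    state_space P t \<Otimes>\<^sub>M borel \<Otimes>\<^sub>M noise_space P (Suc t) \<rightarrow>\<^sub>M borel"

type_synonym ('x, 'u, 'w, 'm) strategy =
  "('x \<times> (real ^ 'm) \<Rightarrow> 'u) \<times> ('x \<times> (real ^ 'm) \<times> 'w \<Rightarrow> (real ^ 'm))"

text \<open>\<open>closed_loop P s t a n\<close> is the pair of states at time \<open>t + n\<close>, started from \<open>a\<close> at time \<open>t\<close>.\<close>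

primrec closed_loop ::
  "('o, 'x, 'u, 'w, 'm::finite) control_problem \<Rightarrow> (nat \<Rightarrow> ('x, 'u, 'w, 'm) strategy) \<Rightarrow>
    nat \<Rightarrow> 'x \<times> (real ^ 'm) \<Rightarrow> nat \<Rightarrow> 'o \<Rightarrow> 'x \<times> (real ^ 'm)" where
  "closed_loop P s t a 0 = (\<lambda>\<omega>. a)"
| "closed_loop P s t a (Suc n) = (\<lambda>\<omega>.
    let (x, z) = closed_loop P s t a n \<omega>;
        w = noise P (Suc (t + n)) \<omega>;
        (\<phi>, \<psi>) = s (t + n)
    in (dynamics P (t + n) (x, \<phi> (x, z), w), z + \<psi> (x, z, w)))"

definition trajectory ::
  "('o, 'x, 'u, 'w, 'm::finite) control_problem \<Rightarrow> (nat \<Rightarrow> ('x, 'u, 'w, 'm) strategy) \<Rightarrow>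
    nat \<Rightarrow> 'x \<times> (real ^ 'm) \<Rightarrow> nat \<Rightarrow> 'o \<Rightarrow> 'x \<times> (real ^ 'm)" where
  "trajectory P s t a \<tau> = closed_loop P s t a (\<tau> - t)"

definition zero_cond_mean ::
  "'o measure \<Rightarrow> 'o measure \<Rightarrow> ('o \<Rightarrow> (real ^ 'm::finite)) \<Rightarrow> bool" where
  "zero_cond_mean M F Y \<longleftrightarrow>
    integrable M Y \<and> (\<forall>i. AE \<omega> in M. real_cond_exp M F (\<lambda>\<omega>. Y \<omega> $ i) \<omega> = 0)"

definition increments_centered ::
  "('o, 'x, 'u, 'w, 'm::finite) control_problem \<Rightarrow> nat \<Rightarrow> 'x \<times> (real ^ 'm) \<Rightarrow>
    (nat \<Rightarrow> ('x, 'u, 'w, 'm) strategy) \<Rightarrow> bool" where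
  "increments_centered P t a s \<longleftrightarrow>
    (\<forall>\<tau> \<in> {t..<horizon P}.
      zero_cond_mean (base P)
        (vimage_algebra (space (base P)) (trajectory P s t a \<tau>) (state_space P \<tau> \<Otimes>\<^sub>M borel))
        (\<lambda>\<omega>. let (x, z) = trajectory P s t a \<tau> \<omega> in snd (s \<tau>) (x, z, noise P (Suc \<tau>) \<omega>)))"

definition total_cost ::
  "('o, 'x, 'u, 'w, 'm::finite) control_problem \<Rightarrow> nat \<Rightarrow> 'x \<times> (real ^ 'm) \<Rightarrow>
    (nat \<Rightarrow> ('x, 'u, 'w, 'm) strategy) \<Rightarrow> ereal" where
  "total_cost P t a s =
    (if increments_centered P t a s
     then enn2ereal (\<integral>\<^sup>+ \<omega>.
        (\<Sum>\<tau> \<in> {t..<horizon P}.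
           let (x, z) = trajectory P s t a \<tau> \<omega>
           in stage_cost P \<tau> (x, fst (s \<tau>) (x, z), noise P (Suc \<tau>) \<omega>))
        + (let (x, z) = trajectory P s t a (horizon P) \<omega>
           in final_cost P x + target_indicator P (x, z)) \<partial>base P)
     else \<infinity>)"


subsection \<open>Time consistency\<close>

text \<open>
  A control sequence from time \<open>t\<close> on is a function that is \<^term>\<open>undefined\<close> outside
  \<open>{t..last_time D}\<close>.
\<close>

record ('a, 'c) opt_data =
  first_time :: nat
  last_time :: nat
  params :: "nat \<Rightarrow> 'a set"
  controls :: "nat \<Rightarrow> 'c set"
  cost :: "nat \<Rightarrow> 'a \<Rightarrow> (nat \<Rightarrow> 'c) \<Rightarrow> ereal"

definition control_sequences :: "('a, 'c) opt_data \<Rightarrow> nat \<Rightarrow> (nat \<Rightarrow> 'c) set" where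
  "control_sequences D t = (\<Pi>\<^sub>E \<tau> \<in> {t..last_time D}. controls D \<tau>)"

definition universal_solution :: "('a, 'c) opt_data \<Rightarrow> nat \<Rightarrow> (nat \<Rightarrow> 'c) \<Rightarrow> bool" where
  "universal_solution D t u \<longleftrightarrow>
    u \<in> control_sequences D t \<and>
    (\<forall>a \<in> params D t. is_arg_min (cost D t a) (\<lambda>v. v \<in> control_sequences D t) u)"

definition time_consistent :: "('a, 'c) opt_data \<Rightarrow> (nat \<Rightarrow> 'c) \<Rightarrow> bool" where
  "time_consistent D u \<longleftrightarrow>
    (\<forall>t \<in> {first_time D..last_time D}.
      universal_solution D t (restrict u {t..last_time D}))"

definition control_data ::
  "('o, 'x, 'u, 'w, 'm::finite) control_problem \<Rightarrow>
    ('x \<times> (real ^ 'm), ('x, 'u, 'w, 'm) strategy) opt_data" where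
  "control_data P =
    \<lparr> first_time = 0,
      last_time = horizon P - 1,
      params = (\<lambda>t. space (state_space P t) \<times> UNIV),
      controls = (\<lambda>t. state_strategies P t \<times> increment_strategies P t),
      cost = total_cost P \<rparr>"

end

theory Submission
  imports Defs
begin

text \<open>
  The pair \<open>(X\<^sub>\<tau>, Z\<^sub>\<tau>)\<close> is a function of the noises up to time \<open>\<tau>\<close>, hence independent of
  \<open>W\<^sub>\<tau>\<^sub>+\<^sub>1\<close>. By Fubini, expectations of functions of both, and conditional expectations given
  the pair, are therefore computed by freezing the pair. So an increment strategy has zero
  conditional mean iff its frozen increment is centered, and hence feasible in the Bellman
  equation, for almost every value of the pair. Backward induction shows that the Bellman value
  bounds every cost from below, with equality for strategies attaining the minima. Finiteness of
  the noise is needed only for the increments of an optimal strategy to be integrable.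
\<close>

section \<open>Conditioning on an independent variable\<close>

lemma borel_measurable_vec_nth' [measurable (raw)]:
  fixes f :: "'a \<Rightarrow> real ^ 'm::finite"
  assumes "f \<in> borel_measurable M"
  shows "(\<lambda>x. f x $ i) \<in> borel_measurable M"
  using assms by (rule measurable_compose)
    (intro borel_measurable_continuous_onI continuous_intros)

text \<open>Independence is stated as an identity of laws: drawing \<open>Y\<close> and
  \<open>W\<close> from one scenario, or from two separate copies of it, gives the same joint law.
  Taking \<open>M \<Otimes>\<^sub>M M\<close> instead of a product of marginal laws keeps every
  frozen integral over the scenario space itself, as in \<open>bellman_objective\<close> and
  \<open>increments\<close>.\<close>

locale independent_pair = prob_space M for M :: "'o measure" +
  fixes N :: "'y measure" and Y :: "'o \<Rightarrow> 'y" and S :: "'w measure" and W :: "'o \<Rightarrow> 'w"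
  assumes measurable_Y [measurable]: "Y \<in> M \<rightarrow>\<^sub>M N"
    and measurable_W [measurable]: "W \<in> M \<rightarrow>\<^sub>M S"
    and distr_pair:
      "distr M (N \<Otimes>\<^sub>M S) (\<lambda>\<omega>. (Y \<omega>, W \<omega>)) =
       distr (M \<Otimes>\<^sub>M M) (N \<Otimes>\<^sub>M S) (\<lambda>p. (Y (fst p), W (snd p)))"
begin

sublocale square: pair_sigma_finite M M
  by unfold_locales

text \<open>Pass to the joint law, replace it through \<open>distr_pair\<close> by a law on the
  square, and apply Tonelli there.\<close>

lemma nn_integral_freeze:
  assumes [measurable]: "h \<in> borel_measurable (N \<Otimes>\<^sub>M S)"
  shows "(\<integral>\<^sup>+ \<omega>. h (Y \<omega>, W \<omega>) \<partial>M) = (\<integral>\<^sup>+ \<omega>. (\<integral>\<^sup>+ \<omega>'. h (Y \<omega>, W \<omega>') \<partial>M) \<partial>M)"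
proof -
  have "(\<integral>\<^sup>+ \<omega>. h (Y \<omega>, W \<omega>) \<partial>M) = (\<integral>\<^sup>+ q. h q \<partial>distr M (N \<Otimes>\<^sub>M S) (\<lambda>\<omega>. (Y \<omega>, W \<omega>)))"
    by (subst nn_integral_distr) auto
  also have "\<dots> = (\<integral>\<^sup>+ p. h (Y (fst p), W (snd p)) \<partial>(M \<Otimes>\<^sub>M M))"
    unfolding distr_pair by (subst nn_integral_distr) auto
  also have "\<dots> = (\<integral>\<^sup>+ \<omega>. (\<integral>\<^sup>+ \<omega>'. h (Y \<omega>, W \<omega>') \<partial>M) \<partial>M)"
    by (subst nn_integral_fst[symmetric]) auto
  finally show ?thesis .
qed

text \<open>Integrability depends only on the law, and \<open>distr_pair\<close> equates the two
  laws. This supplies the hypothesis of Fubini for the next three lemmas.\<close>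

lemma integrable_freeze_pair:
  fixes f :: "_ \<Rightarrow> _::{banach, second_countable_topology}"
  assumes [measurable]: "f \<in> borel_measurable (N \<Otimes>\<^sub>M S)"
    and int: "integrable M (\<lambda>\<omega>. f (Y \<omega>, W \<omega>))"
  shows "integrable (M \<Otimes>\<^sub>M M) (\<lambda>p. f (Y (fst p), W (snd p)))"
proof -
  have "integrable (distr M (N \<Otimes>\<^sub>M S) (\<lambda>\<omega>. (Y \<omega>, W \<omega>))) f"
    using int by (subst integrable_distr_eq) auto
  then show ?thesis
    unfolding distr_pair by (subst (asm) integrable_distr_eq) auto
qed

lemma AE_integrable_freeze:
  fixes f :: "_ \<Rightarrow> _::{banach, second_countable_topology}"
  assumes "f \<in> borel_measurable (N \<Otimes>\<^sub>M S)" and "integrable M (\<lambda>\<omega>. f (Y \<omega>, W \<omega>))"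
  shows "AE \<omega> in M. integrable M (\<lambda>\<omega>'. f (Y \<omega>, W \<omega>'))"
  using square.AE_integrable_fst'[OF integrable_freeze_pair[OF assms]] by simp

lemma integrable_integral_freeze:
  fixes f :: "_ \<Rightarrow> _::{banach, second_countable_topology}"
  assumes "f \<in> borel_measurable (N \<Otimes>\<^sub>M S)" and "integrable M (\<lambda>\<omega>. f (Y \<omega>, W \<omega>))"
  shows "integrable M (\<lambda>\<omega>. \<integral>\<omega>'. f (Y \<omega>, W \<omega>') \<partial>M)"
  using square.integrable_fst'[OF integrable_freeze_pair[OF assms]] by simp

lemma integral_freeze:
  fixes f :: "_ \<Rightarrow> _::{banach, second_countable_topology}"
  assumes [measurable]: "f \<in> borel_measurable (N \<Otimes>\<^sub>M S)"
    and int: "integrable M (\<lambda>\<omega>. f (Y \<omega>, W \<omega>))"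
  shows "(\<integral>\<omega>. f (Y \<omega>, W \<omega>) \<partial>M) = (\<integral>\<omega>. (\<integral>\<omega>'. f (Y \<omega>, W \<omega>') \<partial>M) \<partial>M)"
proof -
  have "(\<integral>\<omega>. f (Y \<omega>, W \<omega>) \<partial>M) = (\<integral>q. f q \<partial>distr M (N \<Otimes>\<^sub>M S) (\<lambda>\<omega>. (Y \<omega>, W \<omega>)))"
    by (subst integral_distr) auto
  also have "\<dots> = (\<integral>p. f (Y (fst p), W (snd p)) \<partial>(M \<Otimes>\<^sub>M M))"
    unfolding distr_pair by (subst integral_distr) auto
  also have "\<dots> = (\<integral>\<omega>. (\<integral>\<omega>'. f (Y \<omega>, W \<omega>') \<partial>M) \<partial>M)"
    using square.integral_fst'[OF integrable_freeze_pair[OF assms]] by simp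
  finally show ?thesis .
qed

lemma real_cond_exp_freeze:
  fixes f :: "'y \<times> 'w \<Rightarrow> real"
  assumes f [measurable]: "f \<in> borel_measurable (N \<Otimes>\<^sub>M S)"
    and int: "integrable M (\<lambda>\<omega>. f (Y \<omega>, W \<omega>))"
  shows "AE \<omega> in M. real_cond_exp M (vimage_algebra (space M) Y N) (\<lambda>\<omega>. f (Y \<omega>, W \<omega>)) \<omega>
                    = (\<integral>\<omega>'. f (Y \<omega>, W \<omega>') \<partial>M)"
proof -
  let ?F = "vimage_algebra (space M) Y N"
  have Y_space: "Y \<in> space M \<rightarrow> space N"
    by (auto intro: measurable_space[OF measurable_Y])
  have "subalgebra M ?F"
    using sets_image_in_sets[OF refl measurable_Y] by (simp add: subalgebra_def)
  then interpret finite_measure_subalgebra M ?F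
    by unfold_locales
  show ?thesis
  proof (rule real_cond_exp_charact)
    show "integrable M (\<lambda>\<omega>. f (Y \<omega>, W \<omega>))" by fact
    show "integrable M (\<lambda>\<omega>. \<integral>\<omega>'. f (Y \<omega>, W \<omega>') \<partial>M)"
      using f int by (rule integrable_integral_freeze)
    have "(\<lambda>y. \<integral>\<omega>'. f (y, W \<omega>') \<partial>M) \<in> borel_measurable N"
      by measurable
    with measurable_vimage_algebra1[OF Y_space]
    show "(\<lambda>\<omega>. \<integral>\<omega>'. f (Y \<omega>, W \<omega>') \<partial>M) \<in> borel_measurable ?F"
      by (rule measurable_compose)
  next
    fix A assume "A \<in> sets ?F"
    then obtain B where B [measurable]: "B \<in> sets N" and A: "A = Y -` B \<inter> space M"
      by (auto simp: sets_vimage_algebra2[OF Y_space])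
    have A' [measurable]: "A \<in> sets M" unfolding A by measurable
    \<comment> \<open>\<open>?g\<close> absorbs the event into the integrand, so that
      \<open>integral_freeze\<close> applies to an integral over all of \<open>M\<close>; the factor
      then leaves the inner integral because it does not involve \<open>W\<close>.\<close>
    let ?g = "\<lambda>q. indicator B (fst q) * f q :: real"
    have ind: "indicator A \<omega> = (indicator B (Y \<omega>) :: real)" if "\<omega> \<in> space M" for \<omega>
      using that by (auto simp: A indicator_def)
    have "integrable M (\<lambda>\<omega>. indicator A \<omega> *\<^sub>R f (Y \<omega>, W \<omega>))"
      using A' int by (rule integrable_mult_indicator)
    then have int_g: "integrable M (\<lambda>\<omega>. ?g (Y \<omega>, W \<omega>))"
      by (rule Bochner_Integration.integrable_cong[OF refl, THEN iffD1, rotated]) (auto simp: ind)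
    have "(\<integral>\<omega>\<in>A. f (Y \<omega>, W \<omega>) \<partial>M) = (\<integral>\<omega>. ?g (Y \<omega>, W \<omega>) \<partial>M)"
      unfolding set_lebesgue_integral_def by (rule Bochner_Integration.integral_cong) (auto simp: ind)
    also have "\<dots> = (\<integral>\<omega>. (\<integral>\<omega>'. ?g (Y \<omega>, W \<omega>') \<partial>M) \<partial>M)"
      by (rule integral_freeze[where f = ?g, OF _ int_g]) measurable
    also have "\<dots> = (\<integral>\<omega>\<in>A. (\<integral>\<omega>'. f (Y \<omega>, W \<omega>') \<partial>M) \<partial>M)"
      unfolding set_lebesgue_integral_def by (rule Bochner_Integration.integral_cong) (auto simp: ind)
    finally show "(\<integral>\<omega>\<in>A. f (Y \<omega>, W \<omega>) \<partial>M) = (\<integral>\<omega>\<in>A. (\<integral>\<omega>'. f (Y \<omega>, W \<omega>') \<partial>M) \<partial>M)" .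
  qed
qed

lemma zero_cond_mean_imp_AE_centered:
  fixes f :: "'y \<times> 'w \<Rightarrow> real ^ 'm::finite"
  assumes [measurable]: "f \<in> borel_measurable (N \<Otimes>\<^sub>M S)"
    and zero: "zero_cond_mean M (vimage_algebra (space M) Y N) (\<lambda>\<omega>. f (Y \<omega>, W \<omega>))"
  shows "AE \<omega> in M. has_bochner_integral M (\<lambda>\<omega>'. f (Y \<omega>, W \<omega>')) 0"
proof -
  have int: "integrable M (\<lambda>\<omega>. f (Y \<omega>, W \<omega>))"
    using zero by (simp add: zero_cond_mean_def)
  have "AE \<omega> in M. (\<integral>\<omega>'. f (Y \<omega>, W \<omega>') $ i \<partial>M) = 0" for i
  proof -
    have "integrable M (\<lambda>\<omega>. f (Y \<omega>, W \<omega>) $ i)"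
      using bounded_linear_vec_nth int by (rule integrable_bounded_linear)
    from real_cond_exp_freeze[OF _ this]
    have "AE \<omega> in M. real_cond_exp M (vimage_algebra (space M) Y N) (\<lambda>\<omega>. f (Y \<omega>, W \<omega>) $ i) \<omega>
            = (\<integral>\<omega>'. f (Y \<omega>, W \<omega>') $ i \<partial>M)"
      by simp
    moreover have "AE \<omega> in M. real_cond_exp M (vimage_algebra (space M) Y N) (\<lambda>\<omega>. f (Y \<omega>, W \<omega>) $ i) \<omega> = 0"
      using zero by (simp add: zero_cond_mean_def)
    ultimately show ?thesis by eventually_elim simp
  qed
  then have "AE \<omega> in M. \<forall>i. (\<integral>\<omega>'. f (Y \<omega>, W \<omega>') $ i \<partial>M) = 0"
    by (simp add: AE_all_countable)
  moreover have "AE \<omega> in M. integrable M (\<lambda>\<omega>'. f (Y \<omega>, W \<omega>'))"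
    by (rule AE_integrable_freeze) (use int in auto)
  ultimately show ?thesis
    by eventually_elim
      (auto simp: has_bochner_integral_iff vec_eq_iff
        integral_bounded_linear[OF bounded_linear_vec_nth, symmetric])
qed

text \<open>Integrability is a hypothesis because centered frozen increments give no bound that is
  uniform in \<open>y\<close>, and so do not control the joint expectation.\<close>

lemma centered_imp_zero_cond_mean:
  fixes f :: "'y \<times> 'w \<Rightarrow> real ^ 'm::finite"
  assumes [measurable]: "f \<in> borel_measurable (N \<Otimes>\<^sub>M S)"
    and int: "integrable M (\<lambda>\<omega>. f (Y \<omega>, W \<omega>))"
    and centered: "\<And>y. y \<in> space N \<Longrightarrow> has_bochner_integral M (\<lambda>\<omega>. f (y, W \<omega>)) 0"
  shows "zero_cond_mean M (vimage_algebra (space M) Y N) (\<lambda>\<omega>. f (Y \<omega>, W \<omega>))"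
  unfolding zero_cond_mean_def
proof (intro conjI allI)
  show "integrable M (\<lambda>\<omega>. f (Y \<omega>, W \<omega>))" by fact
  fix i
  have "integrable M (\<lambda>\<omega>. f (Y \<omega>, W \<omega>) $ i)"
    using bounded_linear_vec_nth int by (rule integrable_bounded_linear)
  then have "AE \<omega> in M. real_cond_exp M (vimage_algebra (space M) Y N) (\<lambda>\<omega>. f (Y \<omega>, W \<omega>) $ i) \<omega>
               = (\<integral>\<omega>'. f (Y \<omega>, W \<omega>') $ i \<partial>M)"
    by (intro real_cond_exp_freeze[where f = "\<lambda>q. f q $ i"]) auto
  then show "AE \<omega> in M. real_cond_exp M (vimage_algebra (space M) Y N) (\<lambda>\<omega>. f (Y \<omega>, W \<omega>) $ i) \<omega> = 0"
    using AE_space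
  proof eventually_elim
    case (elim \<omega>)
    have "Y \<omega> \<in> space N" using elim by (auto intro: measurable_space[OF measurable_Y])
    from centered[OF this] have "(\<integral>\<omega>'. f (Y \<omega>, W \<omega>') $ i \<partial>M) = 0"
      by (auto simp: has_bochner_integral_iff integral_bounded_linear[OF bounded_linear_vec_nth])
    with elim show ?case by simp
  qed
qed

end

lemma (in prob_space) integrable_finite_image:
  fixes f :: "'a \<Rightarrow> _::{banach, second_countable_topology}"
  assumes "f \<in> borel_measurable M" and "finite (f ` space M)"
  shows "integrable M f"
proof -
  have "bounded (f ` space M)" using assms(2) by (rule finite_imp_bounded)
  then obtain B where "\<And>\<omega>. \<omega> \<in> space M \<Longrightarrow> norm (f \<omega>) \<le> B"
    by (auto simp: bounded_iff)
  then show ?thesis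
    using assms(1) by (intro integrable_const_bound[of _ B]) auto
qed


section \<open>The controlled process\<close>

text \<open>The closed loop as a function of the noise sample \<open>v\<close> in place of the scenario.\<close>

primrec noise_path ::
  "('o, 'x, 'u, 'w, 'm::finite) control_problem \<Rightarrow> (nat \<Rightarrow> ('x, 'u, 'w, 'm) strategy) \<Rightarrow>
    nat \<Rightarrow> 'x \<times> (real ^ 'm) \<Rightarrow> nat \<Rightarrow> (nat \<Rightarrow> 'w) \<Rightarrow> 'x \<times> (real ^ 'm)" where
  "noise_path P s t a 0 = (\<lambda>v. a)"
| "noise_path P s t a (Suc n) = (\<lambda>v.
    let (x, z) = noise_path P s t a n v; w = v (Suc (t + n)); (\<phi>, \<psi>) = s (t + n)
    in (dynamics P (t + n) (x, \<phi> (x, z), w), z + \<psi> (x, z, w)))"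

text \<open>The recursion reads the noise only at times in \<open>{Suc t..t + n}\<close>, so the
  value \<open>undefined\<close> that the restriction takes outside \<open>J\<close> never
  enters.\<close>

lemma closed_loop_eq_noise_path:
  assumes "{Suc t..t + n} \<subseteq> J"
  shows "closed_loop P s t a n \<omega> = noise_path P s t a n (\<lambda>k\<in>J. noise P k \<omega>)"
  using assms
proof (induction n)
  case (Suc n)
  then have "Suc (t + n) \<in> J" "{Suc t..t + n} \<subseteq> J" by auto
  with Suc.IH show ?case by (simp add: Let_def)
qed simp

text \<open>Neither optimality nor finiteness of the noise is assumed here, so the locale covers the
  optimal strategy and all its competitors. Measurability is required only at times in
  \<open>{t..<horizon P}\<close>, since a control sequence is \<open>undefined\<close>
  elsewhere.\<close>

locale admissible_strategy = stochastic_control_problem P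
  for P :: "('o, 'x, 'u, 'w, 'm::finite) control_problem" +
  fixes t :: nat and a :: "'x \<times> (real ^ 'm)" and s :: "nat \<Rightarrow> ('x, 'u, 'w, 'm) strategy"
  assumes indep_noise: "indep_vars (noise_space P) (noise P) {1..horizon P}"
    and measurable_bellman_value:
      "\<And>\<tau>. \<tau> \<le> horizon P \<Longrightarrow> bellman_value P \<tau> \<in> borel_measurable (state_space P \<tau> \<Otimes>\<^sub>M borel)"
    and initial_time: "t < horizon P"
    and initial_state: "fst a \<in> space (state_space P t)"
    and measurable_control:
      "\<And>\<tau>. t \<le> \<tau> \<Longrightarrow> \<tau> < horizon P \<Longrightarrow>
        fst (s \<tau>) \<in> state_space P \<tau> \<Otimes>\<^sub>M borel \<rightarrow>\<^sub>M control_space P \<tau>"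
    and measurable_increment:
      "\<And>\<tau>. t \<le> \<tau> \<Longrightarrow> \<tau> < horizon P \<Longrightarrow>
        snd (s \<tau>) \<in> state_space P \<tau> \<Otimes>\<^sub>M borel \<Otimes>\<^sub>M noise_space P (Suc \<tau>) \<rightarrow>\<^sub>M borel"
begin

abbreviation "full_space \<tau> \<equiv> state_space P \<tau> \<Otimes>\<^sub>M (borel :: (real ^ 'm) measure)"

text \<open>This and the next two definitions rebracket the data as functions of
  \<open>((x, z), w)\<close>: the first coordinate is the pair to be frozen, the second the
  independent noise, as \<open>independent_pair\<close> expects.\<close>

definition stage :: "nat \<Rightarrow> ('x \<times> (real ^ 'm)) \<times> 'w \<Rightarrow> ennreal" where
  "stage \<tau> = (\<lambda>((x, z), w). stage_cost P \<tau> (x, fst (s \<tau>) (x, z), w))"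

definition step :: "nat \<Rightarrow> ('x \<times> (real ^ 'm)) \<times> 'w \<Rightarrow> 'x \<times> (real ^ 'm)" where
  "step \<tau> = (\<lambda>((x, z), w). (dynamics P \<tau> (x, fst (s \<tau>) (x, z), w), z + snd (s \<tau>) (x, z, w)))"

definition increment :: "nat \<Rightarrow> ('x \<times> (real ^ 'm)) \<times> 'w \<Rightarrow> real ^ 'm" where
  "increment \<tau> = (\<lambda>((x, z), w). snd (s \<tau>) (x, z, w))"

lemma measurable_stage [measurable]:
  assumes "t \<le> \<tau>" "\<tau> < horizon P"
  shows "stage \<tau> \<in> borel_measurable (full_space \<tau> \<Otimes>\<^sub>M noise_space P (Suc \<tau>))"
proof -
  note [measurable] = stage_cost_measurable[OF assms(2)] measurable_control[OF assms]
  show ?thesis unfolding stage_def split_beta' by measurable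
qed

lemma measurable_step [measurable]:
  assumes "t \<le> \<tau>" "\<tau> < horizon P"
  shows "step \<tau> \<in> full_space \<tau> \<Otimes>\<^sub>M noise_space P (Suc \<tau>) \<rightarrow>\<^sub>M full_space (Suc \<tau>)"
proof -
  note [measurable] = dynamics_measurable[OF assms(2)] measurable_control[OF assms]
    measurable_increment[OF assms]
  show ?thesis unfolding step_def split_beta' by measurable
qed

lemma measurable_increment' [measurable]:
  assumes "t \<le> \<tau>" "\<tau> < horizon P"
  shows "increment \<tau> \<in> borel_measurable (full_space \<tau> \<Otimes>\<^sub>M noise_space P (Suc \<tau>))"
proof -
  note [measurable] = measurable_increment[OF assms]
  show ?thesis unfolding increment_def split_beta' by measurable
qed

lemma noise_path_Suc: "noise_path P s t a (Suc n) v = step (t + n) (noise_path P s t a n v, v (Suc (t + n)))"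
  by (simp add: step_def Let_def split_beta')

lemma closed_loop_Suc:
  "closed_loop P s t a (Suc n) \<omega> = step (t + n) (closed_loop P s t a n \<omega>, noise P (Suc (t + n)) \<omega>)"
  by (simp add: step_def Let_def split_beta')

declare closed_loop.simps(2) [simp del] noise_path.simps(2) [simp del]

section \<open>Independence of the current state and the next noise\<close>

lemma measurable_noise_path:
  assumes "{Suc t..t + n} \<subseteq> J" "t + n \<le> horizon P"
  shows "noise_path P s t a n \<in> PiM J (noise_space P) \<rightarrow>\<^sub>M full_space (t + n)"
  using assms
proof (induction n)
  case 0
  then show ?case using initial_state by (cases a) (auto simp: space_pair_measure)
next
  case (Suc n)
  have J [measurable]: "Suc (t + n) \<in> J" and sub: "{Suc t..t + n} \<subseteq> J" using Suc.prems by auto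
  have [measurable]: "noise_path P s t a n \<in> PiM J (noise_space P) \<rightarrow>\<^sub>M full_space (t + n)"
    using sub Suc by simp
  have [measurable]: "step (t + n) \<in> full_space (t + n) \<Otimes>\<^sub>M noise_space P (Suc (t + n)) \<rightarrow>\<^sub>M full_space (Suc (t + n))"
    using Suc.prems by (intro measurable_step) auto
  show ?case unfolding noise_path_Suc add_Suc_right by measurable
qed

text \<open>The state at time \<open>t + n\<close> is a function of the noise block
  \<open>?A\<close>, which is disjoint from \<open>?B\<close>. Independence of the two blocks is
  carried over to state and next noise by taking image measures.\<close>

lemma independent_pair_closed_loop:
  assumes n: "t + n < horizon P"
  shows "independent_pair (base P) (full_space (t + n)) (closed_loop P s t a n)
           (noise_space P (Suc (t + n))) (noise P (Suc (t + n)))"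
proof -
  let ?M = "base P" and ?k = "Suc (t + n)"
  \<comment> \<open>For \<open>n = 0\<close> the block \<open>?A\<close> is empty and the state is
    the constant \<open>a\<close>; the argument covers this case unchanged.\<close>
  let ?A = "{Suc t..t + n}" and ?B = "{?k}"
  let ?PA = "PiM ?A (noise_space P)" and ?PB = "PiM ?B (noise_space P)"
  let ?X = "\<lambda>\<omega>. \<lambda>k\<in>?A. noise P k \<omega>" and ?V = "\<lambda>\<omega>. \<lambda>k\<in>?B. noise P k \<omega>"
  let ?N = "full_space (t + n)" and ?S = "noise_space P ?k"
  let ?p = "noise_path P s t a n"
  have "indep_var ?PA ?X ?PB ?V"
    using n by (intro indep_var_restrict[OF indep_noise]) auto
  then have X [measurable]: "?X \<in> ?M \<rightarrow>\<^sub>M ?PA" and V [measurable]: "?V \<in> ?M \<rightarrow>\<^sub>M ?PB"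
    and eq: "distr ?M ?PA ?X \<Otimes>\<^sub>M distr ?M ?PB ?V = distr ?M (?PA \<Otimes>\<^sub>M ?PB) (\<lambda>\<omega>. (?X \<omega>, ?V \<omega>))"
    unfolding indep_var_distribution_eq by auto
  have [measurable]: "?p \<in> ?PA \<rightarrow>\<^sub>M ?N"
    using n by (intro measurable_noise_path) auto
  let ?q = "\<lambda>(v, w). (?p v, w ?k)"
  have [measurable]: "?q \<in> ?PA \<Otimes>\<^sub>M ?PB \<rightarrow>\<^sub>M ?N \<Otimes>\<^sub>M ?S" by measurable
  have loop: "closed_loop P s t a n = (\<lambda>\<omega>. ?p (?X \<omega>))"
    by (rule ext) (rule closed_loop_eq_noise_path, simp)
  have sf: "sigma_finite_measure (distr ?M ?PB ?V)"
    by (intro prob_space_imp_sigma_finite prob_space_distr) measurable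
  \<comment> \<open>The product of the two block laws is the law of the blocks read from two
    separate scenarios. Its image under \<open>?q\<close> yields the form required by
    \<open>distr_pair\<close>.\<close>
  have "distr (?M \<Otimes>\<^sub>M ?M) (?PA \<Otimes>\<^sub>M ?PB) (\<lambda>(\<omega>, \<omega>'). (?X \<omega>, ?V \<omega>')) =
        distr ?M (?PA \<Otimes>\<^sub>M ?PB) (\<lambda>\<omega>. (?X \<omega>, ?V \<omega>))"
    using pair_measure_distr[OF X V sf] eq by (rule trans[OF sym])
  from arg_cong[OF this, of "\<lambda>D. distr D (?N \<Otimes>\<^sub>M ?S) ?q"]
  have "distr (?M \<Otimes>\<^sub>M ?M) (?N \<Otimes>\<^sub>M ?S) (\<lambda>p. (?p (?X (fst p)), ?V (snd p) ?k)) =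
        distr ?M (?N \<Otimes>\<^sub>M ?S) (\<lambda>\<omega>. (?p (?X \<omega>), ?V \<omega> ?k))"
    by (simp add: distr_distr comp_def split_beta')
  then have "distr ?M (?N \<Otimes>\<^sub>M ?S) (\<lambda>\<omega>. (closed_loop P s t a n \<omega>, noise P ?k \<omega>)) =
      distr (?M \<Otimes>\<^sub>M ?M) (?N \<Otimes>\<^sub>M ?S) (\<lambda>p. (closed_loop P s t a n (fst p), noise P ?k (snd p)))"
    by (simp add: loop)
  moreover have "closed_loop P s t a n \<in> ?M \<rightarrow>\<^sub>M ?N"
    unfolding loop by measurable
  moreover have "noise P ?k \<in> ?M \<rightarrow>\<^sub>M ?S" using n by (intro noise_measurable) auto
  ultimately show ?thesis
    by (intro independent_pair.intro independent_pair_axioms.intro prob_space_axioms)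
qed

text \<open>With the state frozen, the increment is a measurable function of the next noise alone,
  which gives the inclusion of \<sigma>-fields; only centering remains as a condition.\<close>

lemma increments_iff:
  assumes "t \<le> \<tau>" "\<tau> < horizon P" and y: "y \<in> space (full_space \<tau>)"
  shows "(\<lambda>\<omega>. increment \<tau> (y, noise P (Suc \<tau>) \<omega>)) \<in> increments P \<tau> \<longleftrightarrow>
    has_bochner_integral (base P) (\<lambda>\<omega>. increment \<tau> (y, noise P (Suc \<tau>) \<omega>)) 0"
proof -
  let ?W = "noise P (Suc \<tau>)" and ?S = "noise_space P (Suc \<tau>)" and ?M = "base P"
  have W [measurable]: "?W \<in> ?M \<rightarrow>\<^sub>M ?S" using assms by (intro noise_measurable) auto
  have inc: "(\<lambda>w. increment \<tau> (y, w)) \<in> borel_measurable ?S"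
    using measurable_increment'[OF assms(1,2)] y by measurable
  have "?W \<in> vimage_algebra (space ?M) ?W ?S \<rightarrow>\<^sub>M ?S"
    by (intro measurable_vimage_algebra1) (auto intro: measurable_space[OF W])
  from measurable_compose[OF this inc]
  have "sets (vimage_algebra (space ?M) (\<lambda>\<omega>. increment \<tau> (y, ?W \<omega>)) borel)
          \<subseteq> sets (vimage_algebra (space ?M) ?W ?S)"
    by (intro sets_image_in_sets) auto
  with measurable_compose[OF W inc] show ?thesis by (simp add: increments_def)
qed

lemma bellman_objective_closed_loop:
  "bellman_objective P \<tau> v y (fst (s \<tau>) y) (\<lambda>\<omega>. increment \<tau> (y, noise P (Suc \<tau>) \<omega>)) =
    (\<integral>\<^sup>+ \<omega>. stage \<tau> (y, noise P (Suc \<tau>) \<omega>) + v (step \<tau> (y, noise P (Suc \<tau>) \<omega>)) \<partial>base P)"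
  by (cases y) (simp add: bellman_objective_def stage_def step_def increment_def)

section \<open>Accumulated cost plus Bellman value along a trajectory\<close>

lemma measurable_closed_loop:
  assumes "t + n \<le> horizon P"
  shows "closed_loop P s t a n \<in> base P \<rightarrow>\<^sub>M full_space (t + n)"
proof -
  let ?J = "{Suc t..t + n}"
  have "(\<lambda>\<omega>. \<lambda>k\<in>?J. noise P k \<omega>) \<in> base P \<rightarrow>\<^sub>M PiM ?J (noise_space P)"
    using assms by (intro measurable_restrict noise_measurable) auto
  from measurable_compose[OF this measurable_noise_path[OF order_refl assms]]
  show ?thesis
    by (subst closed_loop_eq_noise_path[OF order_refl, abs_def])
qed

text \<open>This quantity interpolates between the Bellman value at \<open>n = 0\<close> and the
  total cost at \<open>n = horizon P - t\<close>; the two main estimates follow its change from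
  \<open>n\<close> to \<open>Suc n\<close>.\<close>

definition running_value :: "nat \<Rightarrow> ennreal" where
  "running_value n =
    (\<integral>\<^sup>+ \<omega>. (\<Sum>k<n. stage (t + k) (closed_loop P s t a k \<omega>, noise P (Suc (t + k)) \<omega>))
          + bellman_value P (t + n) (closed_loop P s t a n \<omega>) \<partial>base P)"

text \<open>The scenario \<omega> enters only through the current state; the next noise is
  integrated out over a fresh scenario \<omega>'.\<close>

definition frozen_objective :: "nat \<Rightarrow> 'o \<Rightarrow> ennreal" where
  "frozen_objective n \<omega> = (let y = closed_loop P s t a n \<omega> in
    bellman_objective P (t + n) (bellman_value P (Suc (t + n))) y (fst (s (t + n)) y)
      (\<lambda>\<omega>'. increment (t + n) (y, noise P (Suc (t + n)) \<omega>')))"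

lemma running_value_0: "running_value 0 = bellman_value P t a"
  by (simp add: running_value_def emeasure_space_1)

lemma measurable_running_cost:
  assumes "t + n \<le> horizon P"
  shows "(\<lambda>\<omega>. \<Sum>k<n. stage (t + k) (closed_loop P s t a k \<omega>, noise P (Suc (t + k)) \<omega>))
           \<in> borel_measurable (base P)"
proof (rule borel_measurable_sum)
  fix k assume "k \<in> {..<n}"
  with assms have k: "t + k < horizon P" by simp
  have [measurable]: "closed_loop P s t a k \<in> base P \<rightarrow>\<^sub>M full_space (t + k)"
    using k by (intro measurable_closed_loop) simp
  have [measurable]: "noise P (Suc (t + k)) \<in> base P \<rightarrow>\<^sub>M noise_space P (Suc (t + k))"
    using k by (intro noise_measurable) auto
  note [measurable] = measurable_stage[OF _ k, simplified]
  show "(\<lambda>\<omega>. stage (t + k) (closed_loop P s t a k \<omega>, noise P (Suc (t + k)) \<omega>))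
          \<in> borel_measurable (base P)" by measurable
qed

text \<open>Together with \<open>running_value_Suc\<close> this isolates the same accumulated cost
  for \<open>n\<close> and \<open>Suc n\<close>, so that only the second integrals need comparing.
  All terms lie in \<open>ennreal\<close>, hence measurability suffices for the splitting.\<close>

lemma running_value_eq:
  assumes "t + n \<le> horizon P"
  shows "running_value n =
    (\<integral>\<^sup>+ \<omega>. (\<Sum>k<n. stage (t + k) (closed_loop P s t a k \<omega>, noise P (Suc (t + k)) \<omega>)) \<partial>base P) +
    (\<integral>\<^sup>+ \<omega>. bellman_value P (t + n) (closed_loop P s t a n \<omega>) \<partial>base P)"
  unfolding running_value_def
  by (intro nn_integral_add measurable_running_cost assms
      measurable_compose[OF measurable_closed_loop measurable_bellman_value])

text \<open>The newest stage cost and the next Bellman value form one function \<open>?h\<close> of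
  the independent pair; freezing the state turns its expectation into an expected Bellman
  objective.\<close>

lemma running_value_Suc:
  assumes n: "t + n < horizon P"
  shows "running_value (Suc n) =
    (\<integral>\<^sup>+ \<omega>. (\<Sum>k<n. stage (t + k) (closed_loop P s t a k \<omega>, noise P (Suc (t + k)) \<omega>)) \<partial>base P) +
    (\<integral>\<^sup>+ \<omega>. frozen_objective n \<omega> \<partial>base P)"
proof -
  let ?Y = "closed_loop P s t a n" and ?W = "noise P (Suc (t + n))" and ?V = "bellman_value P (Suc (t + n))"
  interpret ind: independent_pair "base P" "full_space (t + n)" ?Y "noise_space P (Suc (t + n))" ?W
    by (rule independent_pair_closed_loop[OF n])
  note [measurable] = measurable_stage[OF _ n, simplified] measurable_step[OF _ n, simplified]
    measurable_bellman_value[OF Suc_leI[OF n]]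
  let ?h = "\<lambda>q. stage (t + n) q + ?V (step (t + n) q)"
  have "running_value (Suc n) =
      (\<integral>\<^sup>+ \<omega>. (\<Sum>k<n. stage (t + k) (closed_loop P s t a k \<omega>, noise P (Suc (t + k)) \<omega>))
             + ?h (?Y \<omega>, ?W \<omega>) \<partial>base P)"
    by (simp add: running_value_def closed_loop_Suc add.assoc)
  also have "\<dots> =
      (\<integral>\<^sup>+ \<omega>. (\<Sum>k<n. stage (t + k) (closed_loop P s t a k \<omega>, noise P (Suc (t + k)) \<omega>)) \<partial>base P) +
      (\<integral>\<^sup>+ \<omega>. ?h (?Y \<omega>, ?W \<omega>) \<partial>base P)"
    using n by (intro nn_integral_add measurable_running_cost) auto
  also have "(\<integral>\<^sup>+ \<omega>. ?h (?Y \<omega>, ?W \<omega>) \<partial>base P) = (\<integral>\<^sup>+ \<omega>. frozen_objective n \<omega> \<partial>base P)"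
    by (subst ind.nn_integral_freeze) (simp_all add: frozen_objective_def[abs_def] bellman_objective_closed_loop Let_def)
  finally show ?thesis .
qed

lemma increments_centered_iff:
  "increments_centered P t a s \<longleftrightarrow> (\<forall>n < horizon P - t.
     zero_cond_mean (base P)
       (vimage_algebra (space (base P)) (closed_loop P s t a n) (full_space (t + n)))
       (\<lambda>\<omega>. increment (t + n) (closed_loop P s t a n \<omega>, noise P (Suc (t + n)) \<omega>)))"
  (is "?L \<longleftrightarrow> (\<forall>n < horizon P - t. ?Z n)")
proof -
  have "?L \<longleftrightarrow> (\<forall>\<tau> \<in> {t..<horizon P}. ?Z (\<tau> - t))"
    unfolding increments_centered_def
    by (intro ball_cong refl) (simp add: trajectory_def increment_def split_beta' Let_def)
  also have "\<dots> \<longleftrightarrow> (\<forall>n < horizon P - t. ?Z n)"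
  proof (intro iffI ballI allI impI)
    fix n assume "\<forall>\<tau> \<in> {t..<horizon P}. ?Z (\<tau> - t)" "n < horizon P - t"
    then show "?Z n" by (auto dest: bspec[where x = "t + n"])
  next
    fix \<tau> assume "\<forall>n < horizon P - t. ?Z n" "\<tau> \<in> {t..<horizon P}"
    then show "?Z (\<tau> - t)" by (auto dest: spec[where x = "\<tau> - t"])
  qed
  finally show ?thesis .
qed

lemma total_cost_eq_running_value:
  assumes "increments_centered P t a s"
  shows "total_cost P t a s = enn2ereal (running_value (horizon P - t))"
proof -
  have "(\<Sum>\<tau> \<in> {t..<horizon P}. let (x, z) = trajectory P s t a \<tau> \<omega>
          in stage_cost P \<tau> (x, fst (s \<tau>) (x, z), noise P (Suc \<tau>) \<omega>))
      = (\<Sum>k<horizon P - t. stage (t + k) (closed_loop P s t a k \<omega>, noise P (Suc (t + k)) \<omega>))" for \<omega>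
    by (rule sum.reindex_bij_witness[where i = "\<lambda>k. t + k" and j = "\<lambda>\<tau>. \<tau> - t"])
      (auto simp: trajectory_def stage_def split_beta' Let_def)
  \<comment> \<open>By \<open>initial_time\<close> the truncated subtraction is exact, so this is
    the terminal branch of the Bellman recursion.\<close>
  moreover have "bellman_value P (t + (horizon P - t)) = (\<lambda>(x, z). final_cost P x + target_indicator P (x, z))"
    using initial_time by (subst bellman_value.simps) simp
  ultimately show ?thesis
    using assms by (simp add: total_cost_def running_value_def trajectory_def)
qed

section \<open>The Bellman value as a lower bound for every cost\<close>

lemma AE_closed_loop_in_space:
  assumes "t + n \<le> horizon P"
  shows "AE \<omega> in base P. closed_loop P s t a n \<omega> \<in> space (full_space (t + n))"
  using measurable_closed_loop[OF assms] by (intro AE_I2) (auto dest: measurable_space)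

text \<open>Along a strategy with centered increments \<open>running_value\<close> never decreases,
  because the strategy's choice at almost every state competes in the Bellman infimum. Otherwise the
  cost is infinite.\<close>

lemma bellman_value_le_total_cost:
  "enn2ereal (bellman_value P t a) \<le> total_cost P t a s"
proof (cases "increments_centered P t a s")
  case True
  have "bellman_value P t a \<le> running_value n" if "n \<le> horizon P - t" for n
    using that
  proof (induction n)
    case 0
    then show ?case by (simp add: running_value_0)
  next
    case (Suc n)
    then have n: "t + n < horizon P" by simp
    let ?Y = "closed_loop P s t a n" and ?W = "noise P (Suc (t + n))"
    interpret ind: independent_pair "base P" "full_space (t + n)" ?Y "noise_space P (Suc (t + n))" ?W
      by (rule independent_pair_closed_loop[OF n])
    have "AE \<omega> in base P. has_bochner_integral (base P) (\<lambda>\<omega>'. increment (t + n) (?Y \<omega>, ?W \<omega>')) 0"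
      using True n by (intro ind.zero_cond_mean_imp_AE_centered measurable_increment')
        (auto simp: increments_centered_iff)
    moreover have "AE \<omega> in base P. ?Y \<omega> \<in> space (full_space (t + n))"
      using n by (intro AE_closed_loop_in_space) simp
    ultimately have "AE \<omega> in base P. bellman_value P (t + n) (?Y \<omega>) \<le> frozen_objective n \<omega>"
    proof eventually_elim
      case (elim \<omega>)
      then have "(\<lambda>\<omega>'. increment (t + n) (?Y \<omega>, ?W \<omega>')) \<in> increments P (t + n)"
        using increments_iff[OF _ n] by simp
      moreover have "fst (s (t + n)) (?Y \<omega>) \<in> space (control_space P (t + n))"
        using measurable_control[OF _ n] elim(2) by (auto dest: measurable_space)
      ultimately show ?case
        using n by (subst bellman_value.simps)
          (auto simp: frozen_objective_def Let_def split_beta' intro!: INF_lower2)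
    qed
    then have "running_value n \<le> running_value (Suc n)"
      unfolding running_value_Suc[OF n] running_value_eq[OF less_imp_le[OF n]]
      by (intro add_left_mono nn_integral_mono_AE)
    with Suc show ?case by simp
  qed
  then show ?thesis
    using True by (simp add: total_cost_eq_running_value less_eq_ennreal.rep_eq[symmetric])
next
  case False
  then show ?thesis by (simp add: total_cost_def)
qed

section \<open>Attainment of the Bellman value by optimal strategies\<close>

lemma finite_closed_loop:
  assumes fin: "\<And>k. k \<in> {1..horizon P} \<Longrightarrow> finite (noise P k ` space (base P))"
    and "t + n \<le> horizon P"
  shows "finite (closed_loop P s t a n ` space (base P))"
  using assms(2)
proof (induction n)
  case 0
  then show ?case by (auto intro: finite_subset[of _ "{a}"])
next
  case (Suc n)
  then have "finite (step (t + n) `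
      (closed_loop P s t a n ` space (base P) \<times> noise P (Suc (t + n)) ` space (base P)))"
    using fin by auto
  then show ?case
    by (rule finite_subset[rotated]) (auto simp: closed_loop_Suc)
qed

lemma total_cost_eq_bellman_value:
  assumes fin: "\<And>k. k \<in> {1..horizon P} \<Longrightarrow> finite (noise P k ` space (base P))"
    and opt: "\<And>\<tau>. t \<le> \<tau> \<Longrightarrow> \<tau> < horizon P \<Longrightarrow> bellman_optimal P \<tau> (fst (s \<tau>)) (snd (s \<tau>))"
  shows "total_cost P t a s = enn2ereal (bellman_value P t a)"
proof -
  have opt': "(\<lambda>\<omega>. increment (t + n) (y, noise P (Suc (t + n)) \<omega>)) \<in> increments P (t + n)"
    "bellman_objective P (t + n) (bellman_value P (Suc (t + n))) y (fst (s (t + n)) y)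
      (\<lambda>\<omega>. increment (t + n) (y, noise P (Suc (t + n)) \<omega>)) = bellman_value P (t + n) y"
    if "t + n < horizon P" "y \<in> space (full_space (t + n))" for n y
    using opt[of "t + n"] that
    by (auto simp: bellman_optimal_def Let_def increment_def space_pair_measure)
  have centered: "increments_centered P t a s"
    unfolding increments_centered_iff
  proof (intro allI impI)
    fix n assume "n < horizon P - t"
    then have n: "t + n < horizon P" by simp
    let ?Y = "closed_loop P s t a n" and ?W = "noise P (Suc (t + n))"
    interpret ind: independent_pair "base P" "full_space (t + n)" ?Y "noise_space P (Suc (t + n))" ?W
      by (rule independent_pair_closed_loop[OF n])
    note inc [measurable] = measurable_increment'[OF _ n, simplified]
    \<comment> \<open>State and next noise take finitely many values, hence so does the increment
      along the trajectory. It is therefore bounded and integrable, as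
      \<open>centered_imp_zero_cond_mean\<close> demands.\<close>
    have "finite (increment (t + n) ` (?Y ` space (base P) \<times> ?W ` space (base P)))"
      using finite_closed_loop[OF fin] n fin by auto
    then have "finite ((\<lambda>\<omega>. increment (t + n) (?Y \<omega>, ?W \<omega>)) ` space (base P))"
      by (rule finite_subset[rotated]) auto
    then have "integrable (base P) (\<lambda>\<omega>. increment (t + n) (?Y \<omega>, ?W \<omega>))"
      by (intro integrable_finite_image) auto
    then show "zero_cond_mean (base P) (vimage_algebra (space (base P)) ?Y (full_space (t + n)))
        (\<lambda>\<omega>. increment (t + n) (?Y \<omega>, ?W \<omega>))"
      using inc opt'(1)[OF n] by (intro ind.centered_imp_zero_cond_mean) (auto simp: increments_def)
  qed
  have "running_value n = bellman_value P t a" if "n \<le> horizon P - t" for n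
    using that
  proof (induction n)
    case 0
    then show ?case by (simp add: running_value_0)
  next
    case (Suc n)
    then have n: "t + n < horizon P" by simp
    have "AE \<omega> in base P. frozen_objective n \<omega> = bellman_value P (t + n) (closed_loop P s t a n \<omega>)"
      using AE_closed_loop_in_space[OF less_imp_le[OF n]]
      by eventually_elim (simp add: frozen_objective_def Let_def opt'(2)[OF n])
    then have "running_value (Suc n) = running_value n"
      unfolding running_value_Suc[OF n] running_value_eq[OF less_imp_le[OF n]]
      by (intro arg_cong2[where f = "(+)"] refl nn_integral_cong_AE)
    with Suc show ?case by simp
  qed
  then show ?thesis
    using centered by (simp add: total_cost_eq_running_value)
qed

end

section \<open>Time consistency of the optimal strategies\<close>

theorem mainTheorem3:
  fixes P :: "('o, 'x, 'u, 'w, 'm::finite) control_problem"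
    and \<phi> :: "nat \<Rightarrow> 'x \<times> (real ^ 'm) \<Rightarrow> 'u"
    and \<psi> :: "nat \<Rightarrow> 'x \<times> (real ^ 'm) \<times> 'w \<Rightarrow> (real ^ 'm)"
  assumes "stochastic_control_problem P"
    and "prob_space.indep_vars (base P) (noise_space P) (noise P) {1..horizon P}"
    and "finite ((\<lambda>\<omega>. \<lambda>t\<in>{1..horizon P}. noise P t \<omega>) ` space (base P))"
    and "\<And>t. t \<le> horizon P \<Longrightarrow>
           bellman_value P t \<in> borel_measurable (state_space P t \<Otimes>\<^sub>M borel)"
    and "\<And>t. t < horizon P \<Longrightarrow> \<phi> t \<in> state_strategies P t"
    and "\<And>t. t < horizon P \<Longrightarrow> \<psi> t \<in> increment_strategies P t"
    and "\<And>t. t < horizon P \<Longrightarrow> bellman_optimal P t (\<phi> t) (\<psi> t)"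
  shows "time_consistent (control_data P) (\<lambda>t. (\<phi> t, \<psi> t))"
proof -
  interpret stochastic_control_problem P by fact
  \<comment> \<open>Evaluation at \<open>k\<close> maps the finite set of noise vectors onto the
    range of the single noise.\<close>
  have fin: "finite (noise P k ` space (base P))" if "k \<in> {1..horizon P}" for k
    using finite_imageI[OF assms(3), of "\<lambda>v. v k"] that by (simp add: image_image)
  have "universal_solution (control_data P) t (restrict (\<lambda>t. (\<phi> t, \<psi> t)) {t..horizon P - 1})"
    (is "universal_solution _ _ ?s") if "t \<in> {0..horizon P - 1}" for t
  proof -
    have t: "t < horizon P" using that horizon_pos by auto
    have idx: "\<tau> \<in> {t..horizon P - 1}" if "t \<le> \<tau>" "\<tau> < horizon P" for \<tau> using that by auto
    \<comment> \<open>Stated for an arbitrary control sequence, this serves twice: for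
      \<open>?s\<close>, to obtain equality with the Bellman value, and for each competitor, to
      obtain the lower bound.\<close>
    have admissible: "admissible_strategy P t a v"
      if "a \<in> params (control_data P) t" "v \<in> control_sequences (control_data P) t" for a v
    proof unfold_locales
      fix \<tau> assume "t \<le> \<tau>" "\<tau> < horizon P"
      then have "v \<tau> \<in> state_strategies P \<tau> \<times> increment_strategies P \<tau>"
        using that(2) idx by (auto simp: control_sequences_def control_data_def PiE_iff)
      then show "fst (v \<tau>) \<in> state_space P \<tau> \<Otimes>\<^sub>M borel \<rightarrow>\<^sub>M control_space P \<tau>"
        "snd (v \<tau>) \<in> state_space P \<tau> \<Otimes>\<^sub>M borel \<Otimes>\<^sub>M noise_space P (Suc \<tau>) \<rightarrow>\<^sub>M borel"
        by (auto simp: state_strategies_def increment_strategies_def)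
    qed (use assms(2,4) t that(1) in \<open>auto simp: control_data_def\<close>)
    have s: "?s \<in> control_sequences (control_data P) t"
      using assms(5,6) horizon_pos by (auto simp: control_sequences_def control_data_def)
    have "is_arg_min (total_cost P t a) (\<lambda>v. v \<in> control_sequences (control_data P) t) ?s"
      if a: "a \<in> params (control_data P) t" for a
    proof -
      interpret opt: admissible_strategy P t a ?s using a s by (rule admissible)
      have "total_cost P t a ?s = enn2ereal (bellman_value P t a)"
        using fin assms(7) idx by (intro opt.total_cost_eq_bellman_value) auto
      moreover have "enn2ereal (bellman_value P t a) \<le> total_cost P t a v"
        if "v \<in> control_sequences (control_data P) t" for v
        using admissible_strategy.bellman_value_le_total_cost[OF admissible[OF a that]] .
      ultimately show ?thesis
        using s by (auto simp: is_arg_min_def not_less)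
    qed
    then show ?thesis using s by (simp add: universal_solution_def control_data_def)
  qed
  then show ?thesis by (simp add: time_consistent_def control_data_def)
qed

end
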